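(* Let $A\in GL_n(\mathbb{F}_q)$. Then $$\mathrm{Im}(\partial\mathrm{char}_A)=\left\{\frac{\mathrm{char}(A)}{\min(A)}\,a:\ a\in\mathbb{F}_q[x],\ \deg a<\deg\min(A)\right\}.$$
   Context: $q$ is a power of an odd prime. $\mathrm{char}(A)=\det(xI-A)$ and $\min(A)$ is the minimal polynomial of $A$. $\partial\mathrm{char}_A:M_n(\mathbb{F}_q)\to\mathbb{F}_q[x]$ is the $\mathbb{F}_q$-linear map $A_1\mapsto\mathrm{tr}\big(\mathrm{Adj}(xI-A)\,A\,A_1\big)$, with $\mathrm{Adj}$ the adjugate matrix. *)

theory Defs
  imports "Jordan_Normal_Form.Char_Poly" "HOL-Library.Cardinality"
begin

definition mat_trace :: "'a :: comm_monoid_add mat \<Rightarrow> 'a" where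
  "mat_trace A = (\<Sum>i<dim_row A. A $$ (i, i))"

text \<open>The value \<open>p(A) = (\<Sum>k. coeff p k \<cdot> A^k)\<close> of a polynomial at a square matrix, given entrywise
  because \<^typ>\<open>'a mat\<close> is not an additive monoid as a type.\<close>

definition eval_poly_mat :: "'a :: comm_ring_1 poly \<Rightarrow> 'a mat \<Rightarrow> 'a mat" where
  "eval_poly_mat p A = mat (dim_row A) (dim_row A)
     (\<lambda>ij. \<Sum>k\<le>degree p. coeff p k * (A ^\<^sub>m k) $$ ij)"

definition min_poly :: "'a :: field mat \<Rightarrow> 'a poly" where
  "min_poly A = (THE p. monic p \<and> eval_poly_mat p A = 0\<^sub>m (dim_row A) (dim_row A) \<and>
     (\<forall>r. r \<noteq> 0 \<and> eval_poly_mat r A = 0\<^sub>m (dim_row A) (dim_row A) \<longrightarrow> degree p \<le> degree r))"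

text \<open>Here \<^term>\<open>char_poly_matrix A\<close> is \<open>xI - A\<close>, and \<open>\<lambda>c. [:c:]\<close> embeds the scalars into the
  polynomials.\<close>

definition dchar :: "'a :: field mat \<Rightarrow> 'a mat \<Rightarrow> 'a poly" where
  "dchar A A1 = mat_trace (adj_mat (char_poly_matrix A) *
     map_mat (\<lambda>c. [:c:]) A * map_mat (\<lambda>c. [:c:]) A1)"

end

theory Submission
  imports Defs
begin

text \<open>Let \<open>m = min(A)\<close>, \<open>d = deg m\<close>, and write \<open>(m(x) - m(y)) / (x - y) = (\<Sum>j<d. g\<^sub>j(x) y^j)\<close>, where \<open>g\<^sub>j\<close>
  is monic of degree \<open>d - 1 - j\<close>. Substituting \<open>A\<close> for \<open>y\<close> inverts \<open>xI - A\<close> up to the factor \<open>m\<close>, so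
  \<open>Adj(xI - A) = char(A)/m \<cdot> (\<Sum>j<d. g\<^sub>j A^j)\<close> and
  \<open>tr(Adj(xI - A) B) = char(A)/m \<cdot> (\<Sum>j<d. tr(A^j B) g\<^sub>j)\<close>. The powers \<open>A^j\<close> with \<open>j < d\<close> are linearly
  independent and the trace form is nondegenerate, so the scalars \<open>tr(A^j B)\<close> can be prescribed
  arbitrarily; as \<open>A\<close> is invertible, \<open>B = A A\<^sub>1\<close> is arbitrary; and the \<open>g\<^sub>j\<close> form a triangular basis of the
  polynomials of degree less than \<open>d\<close>.\<close>

hide_const (open) Module.smult

section \<open>Interpolation by linearly independent functions on a finite set\<close>

text \<open>Gaussian elimination, by induction on \<open>d\<close>: a point \<open>i0\<close> where
  \<open>v d\<close> does not vanish serves as pivot, multiples of \<open>v d\<close> clear the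
  other functions at \<open>i0\<close>, and the induction hypothesis applies on
  \<open>I - {i0}\<close>.\<close>

lemma independent_functions_interpolate:
  fixes v :: "nat \<Rightarrow> 'i \<Rightarrow> 'a :: field"
  assumes "finite I"
    and "\<And>c. (\<And>i. i \<in> I \<Longrightarrow> (\<Sum>j<d. c j * v j i) = 0) \<Longrightarrow> (\<And>j. j < d \<Longrightarrow> c j = 0)"
  shows "d \<le> card I \<and> (\<forall>t. \<exists>w. \<forall>j<d. (\<Sum>i\<in>I. v j i * w i) = t j)"
  using assms
proof (induction d arbitrary: I v)
  case 0
  then show ?case by simp
next
  case (Suc d)
  have "\<exists>i\<in>I. v d i \<noteq> 0"
  proof (rule ccontr)
    assume "\<not> (\<exists>i\<in>I. v d i \<noteq> 0)"
    then have "(\<Sum>j<Suc d. (if j = d then 1 else 0) * v j i) = 0" if "i \<in> I" for i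
      using that by (simp add: if_distrib[of "\<lambda>x. x * _"] cong: if_cong)
    from Suc.prems(2)[of "\<lambda>j. if j = d then 1 else 0", OF this, of d] show False by simp
  qed
  then obtain i0 where i0: "i0 \<in> I" "v d i0 \<noteq> 0" by blast
  define r where "r j = v j i0 / v d i0" for j
  define u where "u j i = v j i - r j * v d i" for j i
  have u_i0: "u j i0 = 0" for j using i0 by (simp add: u_def r_def)
  have indep: "c j = 0" if c: "\<And>i. i \<in> I - {i0} \<Longrightarrow> (\<Sum>j<d. c j * u j i) = 0" and j: "j < d" for c j
  proof -
    \<comment> \<open>The last coefficient is chosen so that a relation among the \<open>u j\<close>
      becomes one among the \<open>v j\<close>.\<close>
    define c' where "c' j = (if j = d then - (\<Sum>j<d. c j * r j) else c j)" for j
    have "(\<Sum>j<Suc d. c' j * v j i) = 0" if "i \<in> I" for i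
    proof -
      have "(\<Sum>j<Suc d. c' j * v j i) = (\<Sum>j<d. c j * u j i)"
        by (simp add: c'_def u_def right_diff_distrib sum_subtractf sum_distrib_right mult.assoc)
      also have "\<dots> = 0" using c that u_i0 by (cases "i = i0") auto
      finally show ?thesis .
    qed
    from Suc.prems(2)[of c', OF this, of j] j show ?thesis by (simp add: c'_def)
  qed
  have IH: "d \<le> card (I - {i0})" "\<exists>w. \<forall>j<d. (\<Sum>i\<in>I - {i0}. u j i * w i) = t j" for t
    using Suc.IH[of "I - {i0}" u] Suc.prems(1) indep by auto
  have "\<exists>w. \<forall>j<Suc d. (\<Sum>i\<in>I. v j i * w i) = t j" for t
  proof -
    from IH(2)[of "\<lambda>j. t j - r j * t d"]
    obtain w where w: "\<And>j. j < d \<Longrightarrow> (\<Sum>i\<in>I - {i0}. u j i * w i) = t j - r j * t d" by blast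
    \<comment> \<open>The value at \<open>i0\<close> is solved from equation \<open>d\<close>; it
      leaves the equations for the \<open>u j\<close> intact because
      \<open>u j i0 = 0\<close>.\<close>
    define w' where "w' = w(i0 := (t d - (\<Sum>i\<in>I - {i0}. v d i * w i)) / v d i0)"
    have split: "(\<Sum>i\<in>I. f i * w' i) = f i0 * w' i0 + (\<Sum>i\<in>I - {i0}. f i * w i)" for f
      using sum.remove[OF Suc.prems(1) i0(1), of "\<lambda>i. f i * w' i"] by (simp add: w'_def)
    have d: "(\<Sum>i\<in>I. v d i * w' i) = t d"
      unfolding split using i0 by (simp add: w'_def)
    have "(\<Sum>i\<in>I. v j i * w' i) = t j" if "j < d" for j
    proof -
      have "(\<Sum>i\<in>I. u j i * w' i) = t j - r j * t d"
        unfolding split using w[OF that] by (simp add: u_i0)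
      moreover have "(\<Sum>i\<in>I. u j i * w' i) = (\<Sum>i\<in>I. v j i * w' i) - r j * (\<Sum>i\<in>I. v d i * w' i)"
        by (simp add: u_def left_diff_distrib sum_subtractf sum_distrib_left mult.assoc)
      ultimately show ?thesis using d by simp
    qed
    then have "\<forall>j<Suc d. (\<Sum>i\<in>I. v j i * w' i) = t j" using d by (auto simp: less_Suc_eq)
    then show ?thesis by blast
  qed
  moreover have "Suc d \<le> card I"
    using IH(1) i0(1) Suc.prems(1) card_Suc_Diff1[of I i0] by simp
  ultimately show ?case by blast
qed

section \<open>Powers of a matrix and its minimal polynomial\<close>

lemma eval_poly_mat_index:
  assumes "A \<in> carrier_mat n n" "i < n" "j < n" "degree p \<le> N"
  shows "eval_poly_mat p A $$ (i, j) = (\<Sum>k\<le>N. coeff p k * (A ^\<^sub>m k) $$ (i, j))"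
proof -
  have "(\<Sum>k\<le>degree p. coeff p k * (A ^\<^sub>m k) $$ (i, j)) = (\<Sum>k\<le>N. coeff p k * (A ^\<^sub>m k) $$ (i, j))"
    by (rule sum.mono_neutral_left) (use assms(4) in \<open>auto simp: coeff_eq_0\<close>)
  then show ?thesis using assms by (simp add: eval_poly_mat_def)
qed

lemma eval_poly_mat_eq_0_iff:
  assumes "A \<in> carrier_mat n n" "degree p \<le> N"
  shows "eval_poly_mat p A = 0\<^sub>m n n \<longleftrightarrow>
    (\<forall>i<n. \<forall>j<n. (\<Sum>k\<le>N. coeff p k * (A ^\<^sub>m k) $$ (i, j)) = 0)"
proof -
  have "dim_row (eval_poly_mat p A) = n" "dim_col (eval_poly_mat p A) = n"
    using assms(1) by (simp_all add: eval_poly_mat_def)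
  then show ?thesis
    using eval_poly_mat_index[OF assms(1) _ _ assms(2)] by (simp add: mat_eq_iff)
qed

text \<open>A nontrivial relation among the powers below \<open>d\<close> would be a nonzero
  annihilator of degree less than \<open>d\<close>.\<close>

lemma powers_independent:
  fixes A :: "'a :: field mat"
  assumes A: "A \<in> carrier_mat n n"
    and min: "\<And>r. r \<noteq> 0 \<Longrightarrow> eval_poly_mat r A = 0\<^sub>m n n \<Longrightarrow> d \<le> degree r"
    and c: "\<And>i. i \<in> {..<n} \<times> {..<n} \<Longrightarrow> (\<Sum>j<d. c j * (A ^\<^sub>m j) $$ i) = 0"
    and j: "j < d"
  shows "c j = 0"
proof -
  define r where "r = (\<Sum>j<d. monom (c j) j)"
  have coeff_r: "coeff r k = (if k < d then c k else 0)" for k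
    by (simp add: r_def coeff_sum)
  have deg: "degree r \<le> d" by (rule degree_le) (simp add: coeff_r)
  have "(\<Sum>k\<le>d. coeff r k * (A ^\<^sub>m k) $$ (i, j)) = 0" if "i < n" "j < n" for i j
  proof -
    have "(\<Sum>k\<le>d. coeff r k * (A ^\<^sub>m k) $$ (i, j)) = (\<Sum>k<d. c k * (A ^\<^sub>m k) $$ (i, j))"
      by (simp add: coeff_r lessThan_Suc_atMost[symmetric])
    then show ?thesis using c[of "(i, j)"] that by simp
  qed
  then have ann: "eval_poly_mat r A = 0\<^sub>m n n" using eval_poly_mat_eq_0_iff[OF A deg] by simp
  have "r = 0"
  proof (rule ccontr)
    assume "r \<noteq> 0"
    with min[OF this ann] have "coeff r (degree r) = 0" by (simp add: coeff_r)
    with \<open>r \<noteq> 0\<close> show False by simp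
  qed
  then show ?thesis using coeff_r[of j] j by simp
qed

text \<open>Matrices are treated as functions on index pairs. With \<open>d\<close> left free, the
  bound on \<open>d\<close> yields an annihilator, and the interpolation yields nondegeneracy of the
  trace form.\<close>

lemma powers_interpolate:
  fixes A :: "'a :: field mat"
  assumes A: "A \<in> carrier_mat n n"
    and min: "\<And>r. r \<noteq> 0 \<Longrightarrow> eval_poly_mat r A = 0\<^sub>m n n \<Longrightarrow> d \<le> degree r"
  shows "d \<le> n * n \<and>
    (\<forall>t. \<exists>w. \<forall>j<d. (\<Sum>i\<in>{..<n} \<times> {..<n}. (A ^\<^sub>m j) $$ i * w i) = t j)"
proof -
  have "d \<le> card ({..<n} \<times> {..<n}) \<and>
    (\<forall>t. \<exists>w. \<forall>j<d. (\<Sum>i\<in>{..<n} \<times> {..<n}. (A ^\<^sub>m j) $$ i * w i) = t j)"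
  proof (rule independent_functions_interpolate)
    fix c j
    assume "\<And>i. i \<in> {..<n} \<times> {..<n} \<Longrightarrow> (\<Sum>j<d. c j * (A ^\<^sub>m j) $$ i) = 0" "j < d"
    then show "c j = 0" using powers_independent[OF A min, where c = c and j = j] by blast
  qed simp
  then show ?thesis by simp
qed

text \<open>Dimension count: otherwise \<open>n * n + 1\<close> powers would be independent in a
  space of dimension \<open>n * n\<close>.\<close>

lemma annihilator_exists:
  fixes A :: "'a :: field mat"
  assumes A: "A \<in> carrier_mat n n"
  shows "\<exists>r. r \<noteq> 0 \<and> eval_poly_mat r A = 0\<^sub>m n n"
proof (rule ccontr)
  assume "\<not> ?thesis"
  then have "\<And>r. r \<noteq> 0 \<Longrightarrow> eval_poly_mat r A = 0\<^sub>m n n \<Longrightarrow> Suc (n * n) \<le> degree r" by blast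
  from powers_interpolate[OF A this] have "Suc (n * n) \<le> n * n" by blast
  then show False by simp
qed

text \<open>Justifies the definite description: an annihilator of least degree is scaled to be
  monic, and two such candidates differ by an annihilator of smaller degree, hence by 0.\<close>

lemma min_poly:
  fixes A :: "'a :: field mat"
  assumes A: "A \<in> carrier_mat n n"
  shows "monic (min_poly A)" "eval_poly_mat (min_poly A) A = 0\<^sub>m n n"
    "\<And>r. r \<noteq> 0 \<Longrightarrow> eval_poly_mat r A = 0\<^sub>m n n \<Longrightarrow> degree (min_poly A) \<le> degree r"
proof -
  let ?ann = "\<lambda>p. eval_poly_mat p A = 0\<^sub>m n n"
  let ?M = "\<lambda>p. monic p \<and> ?ann p \<and> (\<forall>r. r \<noteq> 0 \<and> ?ann r \<longrightarrow> degree p \<le> degree r)"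
  obtain r where r: "r \<noteq> 0" "?ann r"
    and r_min: "\<And>s. s \<noteq> 0 \<and> ?ann s \<Longrightarrow> degree r \<le> degree s"
    using annihilator_exists[OF A] ex_has_least_nat[of "\<lambda>r. r \<noteq> 0 \<and> ?ann r" _ degree] by blast
  define p where "p = smult (inverse (lead_coeff r)) r"
  have "?ann p"
    using r(2) eval_poly_mat_eq_0_iff[OF A, of p "degree r"] eval_poly_mat_eq_0_iff[OF A, of r "degree r"]
    by (simp add: p_def mult.assoc sum_distrib_left[symmetric])
  then have p: "?M p" using r(1) r_min by (auto simp: p_def)
  have "q = p" if q: "?M q" for q
  proof (rule ccontr)
    assume "q \<noteq> p"
    have nz: "p \<noteq> 0" "q \<noteq> 0" using p q by auto
    have deg: "degree q = degree p" using p q nz by (meson le_antisym)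
    have le: "degree (q - p) \<le> degree p" using deg by (simp add: degree_diff_le)
    have "?ann (q - p)"
      using p q eval_poly_mat_eq_0_iff[OF A le] eval_poly_mat_eq_0_iff[OF A, of p "degree p"]
        eval_poly_mat_eq_0_iff[OF A, of q "degree p"] deg
      by (simp add: left_diff_distrib sum_subtractf)
    then have "degree p \<le> degree (q - p)" using p \<open>q \<noteq> p\<close> by simp
    with le have "degree (q - p) = degree p" by simp
    moreover have "coeff (q - p) (degree p) = 0" using p q deg by simp
    ultimately show False using \<open>q \<noteq> p\<close> by (metis leading_coeff_0_iff right_minus_eq)
  qed
  with p have The: "?M (THE q. ?M q)" by (rule theI)
  have eq: "min_poly A = (THE q. ?M q)" by (simp only: min_poly_def carrier_matD(1)[OF A])
  have "?M (min_poly A)" unfolding eq by (rule The)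
  then show "monic (min_poly A)" "?ann (min_poly A)"
    "\<And>r. r \<noteq> 0 \<Longrightarrow> ?ann r \<Longrightarrow> degree (min_poly A) \<le> degree r" by auto
qed

text \<open>The double sum is the trace of \<open>A^j * B\<close>.\<close>

lemma matrix_interpolate_powers:
  fixes A :: "'a :: field mat"
  assumes A: "A \<in> carrier_mat n n"
  shows "\<exists>B \<in> carrier_mat n n. \<forall>j<degree (min_poly A).
    (\<Sum>i<n. \<Sum>l<n. (A ^\<^sub>m j) $$ (i, l) * B $$ (l, i)) = t j"
proof -
  from powers_interpolate[OF A min_poly(3)[OF A]]
  obtain w where w: "\<And>j. j < degree (min_poly A) \<Longrightarrow>
      (\<Sum>i\<in>{..<n} \<times> {..<n}. (A ^\<^sub>m j) $$ i * w i) = t j" by auto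
  \<comment> \<open>Transposing \<open>w\<close> turns the entrywise pairing into the trace
    pairing.\<close>
  let ?B = "mat n n (\<lambda>(l, i). w (i, l))"
  have "(\<Sum>i<n. \<Sum>l<n. (A ^\<^sub>m j) $$ (i, l) * ?B $$ (l, i)) = t j" if "j < degree (min_poly A)" for j
    using w[OF that] by (simp add: sum.cartesian_product split_def)
  then show ?thesis by (intro bexI[of _ ?B]) auto
qed

section \<open>Shifts of a polynomial as a triangular basis\<close>

text \<open>One step of Horner's scheme. The polynomial \<open>g_j\<close> of the overview is
  \<open>poly_shift (Suc j) m\<close>.\<close>

lemma poly_shift_Suc:
  fixes p :: "'a :: comm_ring_1 poly"
  shows "poly_shift j p = [:coeff p j:] + [:0, 1:] * poly_shift (Suc j) p"
  by (rule poly_eqI) (simp add: coeff_poly_shift coeff_pCons split: nat.split)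

text \<open>Triangularity: by induction on the degree bound \<open>e\<close>, a monic shift of the
  right degree removes the top coefficient.\<close>

lemma span_poly_shift:
  fixes m :: "'a :: comm_ring_1 poly"
  assumes "monic m" "e \<le> degree m" "\<And>i. i \<ge> e \<Longrightarrow> coeff a i = 0"
  shows "\<exists>t. a = (\<Sum>j<degree m. smult (t j) (poly_shift (Suc j) m))"
  using assms(2,3)
proof (induction e arbitrary: a)
  case 0
  then have "a = 0" by (intro poly_eqI) simp
  then show ?case by (intro exI[of _ "\<lambda>_. 0"]) simp
next
  case (Suc e)
  \<comment> \<open>This index makes \<open>poly_shift (Suc j) m\<close> monic of degree
    \<open>e\<close>.\<close>
  define j where "j = degree m - Suc e"
  have j: "j < degree m" "degree m = e + Suc j" using Suc.prems(1) by (auto simp: j_def)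
  define b where "b = a - smult (coeff a e) (poly_shift (Suc j) m)"
  have "coeff b i = 0" if "i \<ge> e" for i
  proof (cases "i = e")
    case True
    then show ?thesis using assms(1) j(2) by (simp add: b_def coeff_poly_shift)
  next
    case False
    with that have "i > e" by simp
    then have "coeff m (i + Suc j) = 0" using j(2) by (intro coeff_eq_0) simp
    with \<open>i > e\<close> show ?thesis using Suc.prems(2)[of i] by (simp add: b_def coeff_poly_shift)
  qed
  then obtain t where t: "b = (\<Sum>j<degree m. smult (t j) (poly_shift (Suc j) m))"
    using Suc.IH[of b] Suc.prems(1) by auto
  have "a = (\<Sum>k<degree m. smult ((t(j := t j + coeff a e)) k) (poly_shift (Suc k) m))"
  proof -
    have "(\<Sum>k<degree m. smult ((t(j := t j + coeff a e)) k) (poly_shift (Suc k) m))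
      = (\<Sum>k<degree m. smult (t k) (poly_shift (Suc k) m)
          + (if k = j then smult (coeff a e) (poly_shift (Suc j) m) else 0))"
      by (rule sum.cong) (auto simp: smult_add_left)
    also have "\<dots> = b + smult (coeff a e) (poly_shift (Suc j) m)"
      using j(1) by (simp add: sum.distrib t)
    finally show ?thesis by (simp add: b_def)
  qed
  then show ?case by blast
qed

section \<open>The adjugate of \<open>xI - A\<close> and divisibility of \<open>char\<close> by
  \<open>min\<close>\<close>

lemma index_mult_mat_sum:
  assumes "A \<in> carrier_mat n n" "B \<in> carrier_mat n n" "i < n" "j < n"
  shows "(A * B) $$ (i, j) = (\<Sum>r<n. A $$ (i, r) * B $$ (r, j))"
  using assms by (simp add: scalar_prod_def atLeast0LessThan)

text \<open>The matrix \<open>h(x, A)\<close>, where \<open>h(x, y) = (m(x) - m(y)) / (x - y)\<close>.\<close>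

definition difference_quotient_mat :: "'a :: comm_ring_1 poly \<Rightarrow> 'a mat \<Rightarrow> 'a poly mat" where
  "difference_quotient_mat m A = mat (dim_row A) (dim_row A)
     (\<lambda>il. \<Sum>j<degree m. smult ((A ^\<^sub>m j) $$ il) (poly_shift (Suc j) m))"

text \<open>Substituting \<open>A\<close> for \<open>y\<close> in
  \<open>h(x, y) (x - y) = m(x) - m(y)\<close>, with \<open>m(A) = 0\<close>. The entrywise
  computation telescopes.\<close>

lemma difference_quotient_mat_mult_char_poly_matrix:
  fixes A :: "'a :: comm_ring_1 mat"
  assumes A: "A \<in> carrier_mat n n" and ann: "eval_poly_mat m A = 0\<^sub>m n n"
  shows "difference_quotient_mat m A * char_poly_matrix A = m \<cdot>\<^sub>m 1\<^sub>m n"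
proof (rule eq_matI)
  let ?H = "difference_quotient_mat m A" and ?d = "degree m"
  have H: "?H \<in> carrier_mat n n" using A by (simp add: difference_quotient_mat_def)
  fix i l assume "i < dim_row (m \<cdot>\<^sub>m 1\<^sub>m n :: 'a poly mat)" "l < dim_col (m \<cdot>\<^sub>m 1\<^sub>m n :: 'a poly mat)"
  then have il: "i < n" "l < n" by auto
  \<comment> \<open>The shift is by \<open>j\<close>, not \<open>Suc j\<close>: multiplying the
    \<open>j\<close>-th summand of \<open>?H\<close> by \<open>x\<close> gives \<open>g j\<close>
    minus a constant, and multiplying it by \<open>A\<close> gives \<open>g (Suc j)\<close>.\<close>
  define g where "g j = smult ((A ^\<^sub>m j) $$ (i, l)) (poly_shift j m)" for j
  have "(?H * char_poly_matrix A) $$ (i, l) = (\<Sum>r<n. ?H $$ (i, r) * char_poly_matrix A $$ (r, l))"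
    using index_mult_mat_sum[OF H _ il] A by simp
  also have "\<dots> = (\<Sum>r<n. (if r = l then [:0, 1:] * ?H $$ (i, r) else 0) - smult (A $$ (r, l)) (?H $$ (i, r)))"
    by (rule sum.cong) (use A il in \<open>auto simp: char_poly_matrix_def algebra_simps\<close>)
  also have "\<dots> = [:0, 1:] * ?H $$ (i, l) - (\<Sum>r<n. smult (A $$ (r, l)) (?H $$ (i, r)))"
    using il by (simp add: sum_subtractf)
  also have "(\<Sum>r<n. smult (A $$ (r, l)) (?H $$ (i, r)))
      = (\<Sum>r<n. \<Sum>j<?d. smult ((A ^\<^sub>m j) $$ (i, r) * A $$ (r, l)) (poly_shift (Suc j) m))"
    using A il by (simp add: difference_quotient_mat_def smult_sum2 mult.commute)
  also have "\<dots> = (\<Sum>j<?d. smult (\<Sum>r<n. (A ^\<^sub>m j) $$ (i, r) * A $$ (r, l)) (poly_shift (Suc j) m))"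
    by (subst sum.swap) (simp add: smult_sum)
  also have "\<dots> = (\<Sum>j<?d. g (Suc j))"
    using A il by (simp add: g_def index_mult_mat_sum[of _ n] del: index_mult_mat)
  also have "[:0, 1:] * ?H $$ (i, l) = (\<Sum>j<?d. [:0, 1:] * smult ((A ^\<^sub>m j) $$ (i, l)) (poly_shift (Suc j) m))"
    using A il by (simp add: difference_quotient_mat_def sum_distrib_left del: mult_pCons_left)
  also have "\<dots> = (\<Sum>j<?d. g j - [:coeff m j * (A ^\<^sub>m j) $$ (i, l):])"
  proof (rule sum.cong)
    fix j
    show "[:0, 1:] * smult ((A ^\<^sub>m j) $$ (i, l)) (poly_shift (Suc j) m) =
        g j - [:coeff m j * (A ^\<^sub>m j) $$ (i, l):]"
      unfolding g_def by (subst poly_shift_Suc[of j]) (simp add: smult_add_right mult.commute)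
  qed simp
  also have "\<dots> - (\<Sum>j<?d. g (Suc j)) = (\<Sum>j<?d. g j - g (Suc j)) - [:\<Sum>j<?d. coeff m j * (A ^\<^sub>m j) $$ (i, l):]"
    by (simp add: sum_subtractf sum_to_poly)
  also have "(\<Sum>j<?d. g j - g (Suc j)) = g 0 - g ?d"
    by (rule sum_lessThan_telescope')
  \<comment> \<open>The end of the telescope supplies the leading term missing from the sum over
    \<open>j < ?d\<close>, so the constants add up to an entry of \<open>m(A)\<close>.\<close>
  also have "g ?d = [:coeff m ?d * (A ^\<^sub>m ?d) $$ (i, l):]"
  proof -
    have "poly_shift ?d m = [:coeff m ?d:]"
      by (rule poly_eqI) (auto simp: coeff_poly_shift coeff_pCons coeff_eq_0 split: nat.split)
    then show ?thesis by (simp add: g_def mult.commute)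
  qed
  also have "g 0 - [:coeff m ?d * (A ^\<^sub>m ?d) $$ (i, l):] - [:\<Sum>j<?d. coeff m j * (A ^\<^sub>m j) $$ (i, l):]
      = g 0 - [:\<Sum>j\<le>?d. coeff m j * (A ^\<^sub>m j) $$ (i, l):]"
    by (simp add: lessThan_Suc_atMost[symmetric])
  also have "\<dots> = g 0"
    using ann eval_poly_mat_eq_0_iff[OF A order_refl] il by simp
  also have "\<dots> = (m \<cdot>\<^sub>m 1\<^sub>m n) $$ (i, l)"
    using A il by (simp add: g_def)
  finally show "(?H * char_poly_matrix A) $$ (i, l) = (m \<cdot>\<^sub>m 1\<^sub>m n) $$ (i, l)" .
qed (use A in \<open>auto simp: difference_quotient_mat_def char_poly_matrix_def\<close>)

text \<open>The product \<open>H (xI - A) Adj(xI - A)\<close> is bracketed in two ways.\<close>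

lemma char_poly_difference_quotient_mat:
  fixes A :: "'a :: comm_ring_1 mat"
  assumes A: "A \<in> carrier_mat n n" and ann: "eval_poly_mat m A = 0\<^sub>m n n"
  shows "char_poly A \<cdot>\<^sub>m difference_quotient_mat m A = m \<cdot>\<^sub>m adj_mat (char_poly_matrix A)"
proof -
  let ?C = "char_poly_matrix A" and ?H = "difference_quotient_mat m A"
  have C: "?C \<in> carrier_mat n n" using A by simp
  note adj = adj_mat[OF C]
  have H: "?H \<in> carrier_mat n n" using A by (simp add: difference_quotient_mat_def)
  have "char_poly A \<cdot>\<^sub>m ?H = ?H * (?C * adj_mat ?C)"
    unfolding adj(2) using H mult_smult_distrib[OF H one_carrier_mat] by (simp add: char_poly_def)
  also have "\<dots> = (?H * ?C) * adj_mat ?C"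
    using assoc_mult_mat[OF H C adj(1)] by simp
  also have "\<dots> = m \<cdot>\<^sub>m adj_mat ?C"
    unfolding difference_quotient_mat_mult_char_poly_matrix[OF A ann]
    using mult_smult_assoc_mat[OF one_carrier_mat adj(1)] left_mult_one_mat[OF adj(1)] by simp
  finally show ?thesis .
qed

text \<open>The preceding identity paired with \<open>B\<close> under the trace. The factor
  \<open>m\<close> stays on the left, since divisibility of \<open>char_poly A\<close> by
  \<open>min_poly A\<close> is itself deduced from this equation.\<close>

lemma mult_trace_adj_char_poly_matrix:
  fixes A :: "'a :: comm_ring_1 mat"
  assumes A: "A \<in> carrier_mat n n" and ann: "eval_poly_mat m A = 0\<^sub>m n n"
  shows "m * (\<Sum>i<n. \<Sum>l<n. smult (B $$ (l, i)) (adj_mat (char_poly_matrix A) $$ (i, l))) =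
    char_poly A * (\<Sum>j<degree m. smult (\<Sum>i<n. \<Sum>l<n. (A ^\<^sub>m j) $$ (i, l) * B $$ (l, i)) (poly_shift (Suc j) m))"
proof -
  let ?H = "difference_quotient_mat m A" and ?J = "adj_mat (char_poly_matrix A)"
  have J: "?J \<in> carrier_mat n n" using A by (intro adj_mat(1)) simp
  have H: "?H \<in> carrier_mat n n" using A by (simp add: difference_quotient_mat_def)
  have ent: "m * ?J $$ (i, l) = char_poly A * ?H $$ (i, l)" if "i < n" "l < n" for i l
    using arg_cong[OF char_poly_difference_quotient_mat[OF A ann], of "\<lambda>M. M $$ (i, l)"] that J H by simp
  have "m * (\<Sum>i<n. \<Sum>l<n. smult (B $$ (l, i)) (?J $$ (i, l)))
      = (\<Sum>i<n. \<Sum>l<n. smult (B $$ (l, i)) (m * ?J $$ (i, l)))"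
    by (simp add: sum_distrib_left)
  also have "\<dots> = char_poly A * (\<Sum>i<n. \<Sum>l<n. smult (B $$ (l, i)) (?H $$ (i, l)))"
    by (simp add: ent sum_distrib_left)
  also have "(\<Sum>i<n. \<Sum>l<n. smult (B $$ (l, i)) (?H $$ (i, l)))
      = (\<Sum>i<n. \<Sum>l<n. \<Sum>j<degree m. smult ((A ^\<^sub>m j) $$ (i, l) * B $$ (l, i)) (poly_shift (Suc j) m))"
    using A by (simp add: difference_quotient_mat_def smult_sum2 mult.commute)
  also have "\<dots> = (\<Sum>i<n. \<Sum>j<degree m. \<Sum>l<n. smult ((A ^\<^sub>m j) $$ (i, l) * B $$ (l, i)) (poly_shift (Suc j) m))"
    by (rule sum.cong[OF refl], rule sum.swap)
  also have "\<dots> = (\<Sum>j<degree m. smult (\<Sum>i<n. \<Sum>l<n. (A ^\<^sub>m j) $$ (i, l) * B $$ (l, i)) (poly_shift (Suc j) m))"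
    by (subst sum.swap) (simp add: smult_sum)
  finally show ?thesis .
qed

lemma min_poly_dvd_char_poly:
  fixes A :: "'a :: field mat"
  assumes A: "A \<in> carrier_mat n n"
  shows "min_poly A dvd char_poly A"
proof (cases "degree (min_poly A)")
  case 0
  then have "min_poly A = 1" using min_poly(1)[OF A] monic_degree_0 by blast
  then show ?thesis by simp
next
  case (Suc d)
  let ?m = "min_poly A"
  \<comment> \<open>A trace-dual to the top power picks out of \<open>char * h(x, A) = m * Adj\<close> the coefficient of \<open>A^d\<close>,
    which is \<open>char\<close> because \<open>m\<close> is monic.\<close>
  obtain B where B: "\<And>j. j < degree ?m \<Longrightarrow>
      (\<Sum>i<n. \<Sum>l<n. (A ^\<^sub>m j) $$ (i, l) * B $$ (l, i)) = (if j = d then 1 else 0)"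
    using matrix_interpolate_powers[OF A, of "\<lambda>j. if j = d then 1 else 0"] by blast
  have top: "poly_shift (Suc d) ?m = 1"
    using min_poly(1)[OF A] Suc
    by (intro poly_eqI) (auto simp: coeff_poly_shift coeff_eq_0)
  have "?m * (\<Sum>i<n. \<Sum>l<n. smult (B $$ (l, i)) (adj_mat (char_poly_matrix A) $$ (i, l)))
      = char_poly A * (\<Sum>j<degree ?m. if j = d then poly_shift (Suc j) ?m else 0)"
    unfolding mult_trace_adj_char_poly_matrix[OF A min_poly(2)[OF A]]
    by (intro arg_cong[of _ _ "(*) _"] sum.cong) (auto simp: B)
  also have "\<dots> = char_poly A" using Suc top by simp
  finally show ?thesis by (intro dvdI) (rule sym)
qed

section \<open>The image of \<open>dchar\<close>\<close>

text \<open>Embedding scalars as constant polynomials is a ring homomorphism, so \<open>A\<close>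
  and \<open>A1\<close> can be multiplied before embedding.\<close>

lemma dchar_eq_sum:
  fixes A :: "'a :: field mat"
  assumes A: "A \<in> carrier_mat n n" and A1: "A1 \<in> carrier_mat n n"
  shows "dchar A A1 = (\<Sum>i<n. \<Sum>l<n. smult ((A * A1) $$ (l, i)) (adj_mat (char_poly_matrix A) $$ (i, l)))"
proof -
  interpret lift: comm_ring_hom "\<lambda>c :: 'a. [:c:]" by unfold_locales auto
  let ?J = "adj_mat (char_poly_matrix A)"
  have J: "?J \<in> carrier_mat n n" using A by (intro adj_mat(1)) simp
  have AA: "A * A1 \<in> carrier_mat n n" using A A1 by simp
  have "dchar A A1 = mat_trace (?J * map_mat (\<lambda>c. [:c:]) (A * A1))"
    unfolding dchar_def lift.mat_hom_mult[OF A A1]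
    using assoc_mult_mat[OF J, of "map_mat (\<lambda>c. [:c:]) A" n "map_mat (\<lambda>c. [:c:]) A1" n] A A1 by simp
  also have "\<dots> = (\<Sum>i<n. \<Sum>l<n. ?J $$ (i, l) * [:(A * A1) $$ (l, i):])"
    using J AA A A1 by (simp add: mat_trace_def index_mult_mat_sum[OF J, of "map_mat _ (A * A1)"]
      del: index_mult_mat(1) mult_pCons_right)
  finally show ?thesis by simp
qed

lemma dchar_eq:
  fixes A :: "'a :: field mat"
  assumes A: "A \<in> carrier_mat n n" and A1: "A1 \<in> carrier_mat n n"
  shows "dchar A A1 = char_poly A div min_poly A *
    (\<Sum>j<degree (min_poly A). smult (\<Sum>i<n. \<Sum>l<n. (A ^\<^sub>m j) $$ (i, l) * (A * A1) $$ (l, i))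
      (poly_shift (Suc j) (min_poly A)))"
    (is "_ = _ * ?S")
proof -
  let ?m = "min_poly A"
  have "?m * dchar A A1 = char_poly A * ?S"
    unfolding dchar_eq_sum[OF A A1] by (rule mult_trace_adj_char_poly_matrix[OF A min_poly(2)[OF A]])
  also have "\<dots> = ?m * (char_poly A div ?m * ?S)"
    using min_poly_dvd_char_poly[OF A] by (simp flip: mult.assoc)
  finally show ?thesis using min_poly(1)[OF A] by force
qed

theorem theorem6p1:
  fixes A :: "'a :: {field, finite} mat" and n p k :: nat
  assumes "prime p" and "odd p" and "k \<ge> 1" and "CARD('a) = p ^ k"
    and "A \<in> carrier_mat n n" and "invertible_mat A"
  shows "dchar A ` carrier_mat n n =
    {char_poly A div min_poly A * a | a. a = 0 \<or> degree a < degree (min_poly A)}"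
proof (intro equalityI subsetI)
  note A = assms(5)
  let ?m = "min_poly A"
  fix f assume "f \<in> dchar A ` carrier_mat n n"
  then obtain A1 where A1: "A1 \<in> carrier_mat n n" and f: "f = dchar A A1" by blast
  have "degree (poly_shift (Suc j) ?m) < degree ?m" if "j < degree ?m" for j
  proof -
    have "degree (poly_shift (Suc j) ?m) \<le> degree ?m - 1"
      by (rule degree_le) (auto simp: coeff_poly_shift coeff_eq_0)
    with that show ?thesis by simp
  qed
  then have "degree (\<Sum>j<degree ?m. smult (t j) (poly_shift (Suc j) ?m)) < degree ?m"
    if "degree ?m > 0" for t
    using that by (intro degree_sum_less) (auto intro: le_less_trans[OF degree_smult_le])
  \<comment> \<open>If \<open>degree ?m = 0\<close> the sum is empty, which is the case
    \<open>a = 0\<close>.\<close>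
  then have "(\<Sum>j<degree ?m. smult (t j) (poly_shift (Suc j) ?m)) = 0 \<or>
      degree (\<Sum>j<degree ?m. smult (t j) (poly_shift (Suc j) ?m)) < degree ?m" for t
    by (cases "degree ?m = 0") auto
  moreover obtain t where "f = char_poly A div ?m * (\<Sum>j<degree ?m. smult (t j) (poly_shift (Suc j) ?m))"
    using that dchar_eq[OF A A1] unfolding f .
  ultimately show "f \<in> {char_poly A div ?m * a | a. a = 0 \<or> degree a < degree ?m}" by blast
next
  note A = assms(5)
  let ?m = "min_poly A"
  fix f assume "f \<in> {char_poly A div ?m * a | a. a = 0 \<or> degree a < degree ?m}"
  then obtain a where f: "f = char_poly A div ?m * a" and a: "a = 0 \<or> degree a < degree ?m" by blast
  from a have "coeff a i = 0" if "i \<ge> degree ?m" for i using that by (auto simp: coeff_eq_0)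
  then obtain t where t: "a = (\<Sum>j<degree ?m. smult (t j) (poly_shift (Suc j) ?m))"
    using span_poly_shift[OF min_poly(1)[OF A] order_refl] by blast
  obtain B where B: "B \<in> carrier_mat n n"
    and Bt: "\<And>j. j < degree ?m \<Longrightarrow> (\<Sum>i<n. \<Sum>l<n. (A ^\<^sub>m j) $$ (i, l) * B $$ (l, i)) = t j"
    using matrix_interpolate_powers[OF A, of t] by blast
  obtain C where C: "A * C = 1\<^sub>m n" "C * A = 1\<^sub>m (dim_row C)"
    using assms(6) A by (auto simp: invertible_mat_def inverts_mat_def)
  \<comment> \<open>The shape of \<open>C\<close> is forced by the two products: its columns by
    \<open>A * C\<close>, its rows by \<open>C * A\<close>.\<close>
  have C': "C \<in> carrier_mat n n"
    using C A by (metis carrier_matD(2) carrier_matI index_mult_mat(2,3) index_one_mat(2,3))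
  \<comment> \<open>Invertibility lets \<open>A * A1\<close> be any prescribed \<open>B\<close>,
    with \<open>A1 = C * B\<close>.\<close>
  have AC: "A * (C * B) = B" using assoc_mult_mat[OF A C' B] C(1) B by simp
  have "dchar A (C * B) = f"
    unfolding dchar_eq[OF A mult_carrier_mat[OF C' B]] AC f t by (simp add: Bt)
  then show "f \<in> dchar A ` carrier_mat n n" using C' B by force
qed

end
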